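(* Let $r\in(1/2,1)$ and let $H\subseteq S^1$ be a finite set which is $2\cos^{-1}\!\left(\frac{5-4r^2}{4}\right)$-dense in $S^1$. Then $A_{[r,1)}\subseteq R^{*}(H)$, and $R(H)$ is dense in $A_{[r,r^{-1}]}$ (that is, $A_{[r,r^{-1}]}\subseteq\overline{R(H)}$).
   Context: $S^1=\{z\in\mathbb{C}:|z|=1\}$. For an interval $I\subseteq\mathbb{R}$, $A_I=\{z\in\mathbb{C}:|z|\in I\}$. For a finite set $H\subseteq\mathbb{C}$, the root set of polynomials with coefficients in $H$ is $$R(H)=\Big\{z\in\mathbb{C}:\ \exists\, k>0 \text{ an integer},\ \exists\,(a_0,\dots,a_k)\in H^{k+1},\ \sum_{n=0}^{k}a_nz^n=0\Big\},$$ and the root set of power series with coefficients in $H$ is $$R^{*}(H)=\Big\{z\in\mathbb{C}:\ \exists\,(a_n)_{n\ge 0}\text{ with } a_n\in H \text{ for all } n,\ \sum_{n=0}^{\infty}a_nz^n=0\Big\},$$ where the equation means that the series converges with sum $0$. $\overline{A}$ denotes the closure of $A$ in $\mathbb{C}$, and $\cos^{-1}$ is the inverse cosine with values in $[0,\pi]$. Angles on $S^1$ are measured by the angular (arc-length) metric $d$, where $d(e^{i\theta},e^{i\theta'})\in[0,\pi]$ is the interior angle between the radii through $e^{i\theta}$ and $e^{i\theta'}$. For $0<\varepsilon<2\pi$, a set $H\subseteq S^1$ is called $\varepsilon$-dense in $S^1$ if every closed arc of $S^1$ of angular length $\varepsilon$ contains a point of $H$. *)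

theory Defs
  imports "HOL-Analysis.Analysis"
begin

definition annulus :: "real set \<Rightarrow> complex set" where
  "annulus I = {z. cmod z \<in> I}"

definition poly_root_set :: "complex set \<Rightarrow> complex set" where
  "poly_root_set H =
     {z. \<exists>k>0. \<exists>a :: nat \<Rightarrow> complex. (\<forall>n\<le>k. a n \<in> H) \<and> (\<Sum>n\<le>k. a n * z ^ n) = 0}"

definition power_series_root_set :: "complex set \<Rightarrow> complex set" where
  "power_series_root_set H =
     {z. \<exists>a :: nat \<Rightarrow> complex. (\<forall>n. a n \<in> H) \<and> (\<lambda>n. a n * z ^ n) sums 0}"

text \<open>For \<open>0 \<le> \<epsilon> \<le> 2 * pi\<close>, the closed arc of the unit circle running counterclockwise
  from \<open>cis \<theta>\<close>, of angular length \<open>\<epsilon>\<close>.\<close>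

definition closed_arc :: "real \<Rightarrow> real \<Rightarrow> complex set" where
  "closed_arc \<theta> \<epsilon> = cis ` {\<theta>..\<theta> + \<epsilon>}"

text \<open>Only meaningful for \<open>0 < \<epsilon> < 2 * pi\<close> and \<open>H \<subseteq> sphere 0 1\<close>.\<close>

definition arc_dense :: "real \<Rightarrow> complex set \<Rightarrow> bool" where
  "arc_dense \<epsilon> H \<longleftrightarrow> (\<forall>\<theta>. closed_arc \<theta> \<epsilon> \<inter> H \<noteq> {})"

end

theory Submission
  imports Defs "HOL-Complex_Analysis.Complex_Analysis"
begin

text \<open>
  The remainders \<open>w\<^sub>n = (\<Sum>k<n. a\<^sub>k z ^ k) / z ^ n\<close> satisfy \<open>w\<^sub>n\<^sub>+\<^sub>1 = (w\<^sub>n + a\<^sub>n) / z\<close>, so it suffices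
  to choose the coefficients greedily such that the remainders stay in a fixed disc. The density
  assumption provides a coefficient at angle at most \<open>arccos ((5 - 4 r\<^sup>2) / 4)\<close> from \<open>- w\<^sub>n\<close>, and the
  law of cosines shows that the disc of radius 2 is then preserved whenever \<open>r \<le> |z| < 1\<close>. By
  Hurwitz's theorem, the zeros of the resulting power series are limits of zeros of its partial sums.
  The part of the annulus outside the unit disc is reached by reversing the coefficients of a
  polynomial, which inverts its roots.
\<close>

text \<open>The greedy choice as a recursion starting at 0: the remainders never leave the disc of
  radius \<open>B\<close>, so the \<open>n\<close>-th partial sum \<open>w n * z ^ n\<close> has
  modulus at most \<open>B * cmod z ^ n\<close>, which tends to 0.\<close>

lemma power_series_root_of_contraction:
  fixes z :: complex
  assumes "z \<noteq> 0" "cmod z < 1" "0 \<le> B"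
    and step: "\<And>w. cmod w \<le> B \<Longrightarrow> \<exists>a\<in>H. cmod (w + a) \<le> B * cmod z"
  shows "z \<in> power_series_root_set H"
proof -
  obtain f where f: "\<And>w. cmod w \<le> B \<Longrightarrow> f w \<in> H"
      "\<And>w. cmod w \<le> B \<Longrightarrow> cmod (w + f w) \<le> B * cmod z"
    using step by metis
  define w where "w = rec_nat 0 (\<lambda>_ v. (v + f v) / z)"
  have w_simps: "w 0 = 0" "w (Suc n) = (w n + f (w n)) / z" for n
    by (simp_all add: w_def)
  have w_le: "cmod (w n) \<le> B" for n
  proof (induction n)
    case (Suc n)
    then show ?case
      using f(2)[of "w n"] \<open>z \<noteq> 0\<close> by (simp add: w_simps norm_divide divide_le_eq)
  qed (simp add: w_simps \<open>0 \<le> B\<close>)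
  have partial: "(\<Sum>k<n. f (w k) * z ^ k) = w n * z ^ n" for n
    by (induction n) (use \<open>z \<noteq> 0\<close> in \<open>simp_all add: w_simps field_simps\<close>)
  have "(\<lambda>n. w n * z ^ n) \<longlonglongrightarrow> 0"
  proof (rule Lim_null_comparison)
    show "(\<lambda>n. B * cmod z ^ n) \<longlonglongrightarrow> 0"
      using \<open>cmod z < 1\<close> by (intro tendsto_mult_right_zero LIMSEQ_power_zero) simp
  qed (auto simp: norm_mult norm_power w_le intro!: always_eventually mult_right_mono)
  then have "(\<lambda>n. f (w n) * z ^ n) sums 0"
    by (simp add: sums_def partial)
  then show ?thesis
    unfolding power_series_root_set_def
    using f(1)[OF w_le] by (auto intro!: exI[of _ "\<lambda>n. f (w n)"])
qed

text \<open>The half-length \<open>arccos c\<close> of the arc is chosen so that the law of cosines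
  yields exactly \<open>2 * r\<close> in the extreme case \<open>cmod w = 2\<close>: there
  \<open>4 + 1 - 4 * c = 4 * r\<^sup>2\<close>.\<close>

lemma arc_dense_contraction:
  assumes "1 / 2 < r" "r < 1"
    and "H \<subseteq> sphere 0 1"
    and dense: "arc_dense (2 * arccos ((5 - 4 * r\<^sup>2) / 4)) H"
    and "cmod w \<le> 2"
  shows "\<exists>a\<in>H. cmod (w + a) \<le> 2 * r"
proof -
  define c where "c = (5 - 4 * r\<^sup>2) / 4"
  have "1 / 4 < r\<^sup>2" "r\<^sup>2 < 1"
    using power_strict_mono[of "1 / 2" r 2] power_strict_mono[of r 1 2] assms(1,2)
    by (simp_all add: power2_eq_square)
  then have c: "0 \<le> c" "c \<le> 1"
    by (simp_all add: c_def)
  define \<phi> where "\<phi> = Arg w"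
  have w: "w = of_real (cmod w) * cis \<phi>"
    using rcis_cmod_Arg[of w] by (simp add: \<phi>_def rcis_def)
  \<comment> \<open>The arc is centred at the angle \<open>\<phi> + pi\<close> of
    \<open>- w\<close>. For \<open>w = 0\<close> any direction serves.\<close>
  obtain t where t: "cis t \<in> H" "\<phi> + pi - arccos c \<le> t" "t \<le> \<phi> + pi + arccos c"
    using dense[unfolded arc_dense_def closed_arc_def, rule_format, of "\<phi> + pi - arccos c"]
    by (auto simp: c_def algebra_simps)
  have "cos (arccos c) \<le> cos \<bar>t - \<phi> - pi\<bar>"
    using t c arccos_ubound[of c] by (intro cos_monotone_0_pi_le) auto
  then have "c \<le> cos (t - \<phi> - pi)"
    using c by simp
  then have cos_le: "cos (t - \<phi>) \<le> - c"
    by (simp add: cos_diff)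
  have "(cmod (w + cis t))\<^sup>2 = (cmod w)\<^sup>2 + 1 + 2 * cmod w * cos (t - \<phi>)"
  proof -
    have "(cmod (w + cis t))\<^sup>2
        = (cmod w * cos \<phi> + cos t)\<^sup>2 + (cmod w * sin \<phi> + sin t)\<^sup>2"
      by (subst w) (simp add: cmod_power2)
    also have "\<dots> = (cmod w)\<^sup>2 * ((cos \<phi>)\<^sup>2 + (sin \<phi>)\<^sup>2) + ((cos t)\<^sup>2 + (sin t)\<^sup>2)
        + 2 * cmod w * cos (t - \<phi>)"
      unfolding cos_diff by algebra
    finally show ?thesis by simp
  qed
  also have "\<dots> \<le> (cmod w)\<^sup>2 + 1 - 2 * cmod w * c"
    using mult_left_mono[OF cos_le, of "2 * cmod w"] by simp
  \<comment> \<open>By the choice of \<open>c\<close>, the excess over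
    \<open>(2 * r)\<^sup>2\<close> is a quadratic in \<open>cmod w\<close> with root 2. Its other
    root is negative because \<open>r > 1 / 2\<close>, so it is nonpositive for
    \<open>cmod w\<close> between 0 and 2.\<close>
  also have "\<dots> = (2 * r)\<^sup>2 - (2 - cmod w) * (cmod w + (4 * r\<^sup>2 - 1) / 2)"
    by (simp add: c_def power2_eq_square field_simps)
  also have "\<dots> \<le> (2 * r)\<^sup>2"
    using \<open>cmod w \<le> 2\<close> \<open>1 / 4 < r\<^sup>2\<close> by simp
  finally have "cmod (w + cis t) \<le> 2 * r"
    by (rule power2_le_imp_le) (use \<open>1 / 2 < r\<close> in simp)
  then show ?thesis
    using t(1) by blast
qed

text \<open>If no partial sum of positive degree vanished near \<open>z\<close>, Hurwitz's theorem
  would make the limit zero-free there as well. The condition on \<open>a 0\<close> excludes the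
  zero series.\<close>

lemma partial_sum_root_near:
  fixes a :: "nat \<Rightarrow> complex"
  assumes "a 0 \<noteq> 0" "ereal (cmod z) < conv_radius a"
    and root: "(\<lambda>n. a n * z ^ n) sums 0" and "0 < e"
  shows "\<exists>k>0. \<exists>w\<in>ball z e. (\<Sum>n\<le>k. a n * w ^ n) = 0"
proof (rule ccontr)
  assume contra: "\<not> ?thesis"
  obtain R where R: "cmod z < R" "ereal R < conv_radius a"
    using ereal_dense2[OF assms(2)] by auto
  define g where "g = (\<lambda>w. \<Sum>n. a n * w ^ n)"
  \<comment> \<open>The radius keeps \<open>S\<close> inside both \<open>ball z e\<close> and the
    disc \<open>ball 0 R\<close> of convergence.\<close>
  define S where "S = ball z (min e (R - cmod z))"
  have "z \<in> S"
    using \<open>0 < e\<close> R by (simp add: S_def)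
  have S_sub: "S \<subseteq> ball 0 R"
  proof
    fix w assume "w \<in> S"
    then show "w \<in> ball 0 R"
      using norm_triangle_sub[of w z] by (simp add: S_def dist_norm norm_minus_commute)
  qed
  have g_sums: "(\<lambda>n. a n * w ^ n) sums g w" if "w \<in> ball 0 R" for w
  proof -
    have "ereal (norm w) < conv_radius a"
      using that R(2) by (auto intro: less_trans[of _ "ereal R"])
    then show ?thesis
      by (simp add: g_def summable_in_conv_radius summable_sums)
  qed
  have g_hol: "g holomorphic_on ball 0 R"
    by (rule power_series_holomorphic[where a = a]) (simp add: g_sums)
  have "g z = 0" "g 0 = a 0"
    using root by (auto simp: g_def sums_iff)
  \<comment> \<open>A constant value would be \<open>g z = 0\<close>, and the identity theorem would
    carry it from \<open>S\<close> to the origin.\<close>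
  have nonconst: "\<not> g constant_on S"
  proof
    assume "g constant_on S"
    then have "g w = 0" if "w \<in> S" for w
      using that \<open>z \<in> S\<close> \<open>g z = 0\<close> by (metis constant_on_def)
    then have "g 0 = 0"
      using analytic_continuation_open[of S "ball 0 R" g "\<lambda>_. 0" 0] S_sub \<open>z \<in> S\<close> g_hol
        le_less_trans[OF norm_ge_zero R(1)]
      by (auto simp: S_def)
    with \<open>g 0 = a 0\<close> \<open>a 0 \<noteq> 0\<close> show False
      by simp
  qed
  \<comment> \<open>The shift to \<open>Suc n\<close> drops the partial sum consisting of
    \<open>a 0\<close> alone, since roots are wanted for \<open>k > 0\<close>.\<close>
  have lim: "uniform_limit (cball 0 R) (\<lambda>n w. \<Sum>i\<le>Suc n. a i * w ^ i) g sequentially"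
  proof -
    have "uniform_limit (cball 0 R) (\<lambda>n w. \<Sum>i<n. a i * w ^ i) g sequentially"
      using powser_uniform_limit[OF R(2), of 0] by (simp add: g_def)
    from filterlim_compose[OF this filterlim_sequentially_Suc[THEN iffD2, OF filterlim_Suc]]
    show ?thesis
      by (simp only: lessThan_Suc_atMost)
  qed
  have "g z \<noteq> 0"
  proof (rule Hurwitz_no_zeros[of S "\<lambda>n w. \<Sum>i\<le>Suc n. a i * w ^ i" g z])
    show "uniform_limit K (\<lambda>n w. \<Sum>i\<le>Suc n. a i * w ^ i) g sequentially"
      if "compact K" "K \<subseteq> S" for K
      using that S_sub by (intro uniform_limit_on_subset[OF lim]) force
    show "(\<Sum>i\<le>Suc n. a i * w ^ i) \<noteq> 0" if "w \<in> S" for n w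
    proof -
      have "w \<in> ball z e"
        using that by (simp add: S_def)
      then show ?thesis
        using contra by (metis zero_less_Suc)
    qed
  qed (use \<open>z \<in> S\<close> nonconst holomorphic_on_subset[OF g_hol S_sub] in
      \<open>auto simp: S_def simp del: sum.atMost_Suc intro!: holomorphic_intros\<close>)
  with \<open>g z = 0\<close> show False
    by simp
qed

text \<open>Comparison with a geometric series.\<close>

lemma conv_radius_ge_1:
  fixes a :: "nat \<Rightarrow> 'a :: {banach, real_normed_div_algebra}"
  assumes "\<And>n. norm (a n) \<le> B"
  shows "1 \<le> conv_radius a"
proof (rule conv_radius_geI_ex')
  fix \<rho> :: real
  assume \<rho>: "0 < \<rho>" "ereal \<rho> < 1"
  have "summable (\<lambda>n. B * \<rho> ^ n)"
    using \<rho> by (intro summable_mult summable_geometric) simp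
  then show "summable (\<lambda>n. a n * of_real \<rho> ^ n)"
    by (rule summable_comparison_test[rotated])
      (use \<rho> assms in \<open>auto simp: norm_mult norm_power intro!: mult_right_mono\<close>)
qed

text \<open>Coefficients of modulus 1 supply both the radius of convergence and the nonzero constant
  term required by \<open>partial_sum_root_near\<close>.\<close>

lemma power_series_root_in_closure:
  assumes "H \<subseteq> sphere 0 1" "cmod z < 1" "z \<in> power_series_root_set H"
  shows "z \<in> closure (poly_root_set H)"
proof -
  obtain a where a: "\<And>n. a n \<in> H" "(\<lambda>n. a n * z ^ n) sums 0"
    using assms(3) by (auto simp: power_series_root_set_def)
  then have norm_a: "cmod (a n) = 1" for n
    using assms(1) by (auto simp: subset_iff)
  then have "1 \<le> conv_radius a"
    by (intro conv_radius_ge_1[of a 1]) simp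
  with assms(2) have rad: "ereal (cmod z) < conv_radius a"
    by (metis ereal_less(3) less_le_trans)
  have "a 0 \<noteq> 0"
    using norm_a[of 0] by auto
  show ?thesis
    unfolding closure_approachable
  proof (intro allI impI)
    fix e :: real
    assume "0 < e"
    then obtain k w where "k > 0" "w \<in> ball z e" "(\<Sum>n\<le>k. a n * w ^ n) = 0"
      using partial_sum_root_near[OF \<open>a 0 \<noteq> 0\<close> rad a(2)] by blast
    then have "w \<in> poly_root_set H"
      using a(1) unfolding poly_root_set_def by blast
    with \<open>w \<in> ball z e\<close> show "\<exists>w\<in>poly_root_set H. dist w z < e"
      by (auto simp: dist_commute)
  qed
qed

text \<open>Reversing the coefficients divides the value by \<open>z ^ k\<close> and replaces
  \<open>z\<close> by its inverse. The case \<open>z = 0\<close> is covered by the convention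
  \<open>inverse 0 = 0\<close>.\<close>

lemma inverse_in_poly_root_set:
  assumes "z \<in> poly_root_set H"
  shows "inverse z \<in> poly_root_set H"
proof (cases "z = 0")
  case False
  obtain k a where a: "k > 0" "\<And>n. n \<le> k \<Longrightarrow> a n \<in> H" "(\<Sum>n\<le>k. a n * z ^ n) = 0"
    using assms by (auto simp: poly_root_set_def)
  have "(\<Sum>n\<le>k. a (k - n) * inverse z ^ n) = (\<Sum>n\<le>k. a n * inverse z ^ (k - n))"
    by (rule sum.reindex_bij_witness[of _ "\<lambda>n. k - n" "\<lambda>n. k - n"]) auto
  also have "\<dots> = (\<Sum>n\<le>k. a n * z ^ n) * inverse z ^ k"
    unfolding sum_distrib_right
  proof (rule sum.cong)
    fix n assume "n \<in> {..k}"
    then have "inverse z ^ k = inverse z ^ n * inverse z ^ (k - n)"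
      by (simp flip: power_add)
    moreover have "z ^ n * inverse z ^ n = 1"
      using False by (simp flip: power_mult_distrib)
    ultimately show "a n * inverse z ^ (k - n) = a n * z ^ n * inverse z ^ k"
      by (metis mult.assoc mult_1)
  qed simp
  finally have "(\<Sum>n\<le>k. a (k - n) * inverse z ^ n) = 0"
    by (simp add: a(3))
  then show ?thesis
    using a(1,2) unfolding poly_root_set_def by (auto intro!: exI[of _ k] exI[of _ "\<lambda>n. a (k - n)"])
qed (use assms in simp)

lemma inverse_in_closure_poly_root_set:
  assumes "z \<in> closure (poly_root_set H)" "z \<noteq> 0"
  shows "inverse z \<in> closure (poly_root_set H)"
proof -
  obtain x where x: "\<And>n. x n \<in> poly_root_set H" "x \<longlonglongrightarrow> z"
    using assms(1) by (auto simp: closure_sequential)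
  have "(\<lambda>n. inverse (x n)) \<longlonglongrightarrow> inverse z"
    using x(2) assms(2) by (rule tendsto_inverse)
  then show ?thesis
    unfolding closure_sequential
    using inverse_in_poly_root_set[OF x(1)] by (intro exI[of _ "\<lambda>n. inverse (x n)"]) simp
qed

text \<open>This brings in the unit circle, where the power series argument does not apply: its
  points are approached radially from inside.\<close>

lemma annulus_closed_subset_closure:
  assumes "r < 1"
  shows "annulus {r..1} \<subseteq> closure (annulus {r..<1})"
proof
  fix z assume z: "z \<in> annulus {r..1}"
  show "z \<in> closure (annulus {r..<1})"
  proof (cases "cmod z < 1")
    case True
    then show ?thesis
      using z closure_subset by (force simp: annulus_def)
  next
    case False
    then have z1: "cmod z = 1"
      using z by (simp add: annulus_def)
    show ?thesis
      unfolding closure_approachable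
    proof (intro allI impI)
      fix e :: real
      assume "0 < e"
      \<comment> \<open>The term \<open>1 - e / 2\<close> places \<open>t * z\<close> within
        \<open>e\<close> of \<open>z\<close>; the maximum with 0 makes \<open>t\<close> the modulus
        of \<open>t * z\<close> even for negative \<open>r\<close>.\<close>
      define t where "t = max (max r 0) (1 - e / 2)"
      have t: "r \<le> t" "0 \<le> t" "t < 1" "1 - t < e"
        using \<open>0 < e\<close> \<open>r < 1\<close> by (auto simp: t_def)
      have "of_real t * z - z = of_real (t - 1) * z"
        by (simp add: algebra_simps)
      then have "dist (of_real t * z) z < e"
        using t z1 by (simp only: dist_norm norm_mult norm_of_real) simp
      moreover have "of_real t * z \<in> annulus {r..<1}"
        using t z1 by (simp add: annulus_def norm_mult)
      ultimately show "\<exists>y\<in>annulus {r..<1}. dist y z < e"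
        by blast
    qed
  qed
qed

theorem theorem1p1:
  fixes r :: real and H :: "complex set"
  assumes "1 / 2 < r" and "r < 1"
    and "finite H" and "H \<subseteq> sphere 0 1"
    and "arc_dense (2 * arccos ((5 - 4 * r\<^sup>2) / 4)) H"
  shows "annulus {r..<1} \<subseteq> power_series_root_set H
    \<and> annulus {r..inverse r} \<subseteq> closure (poly_root_set H)"
proof
  show series: "annulus {r..<1} \<subseteq> power_series_root_set H"
  proof
    fix z assume z: "z \<in> annulus {r..<1}"
    show "z \<in> power_series_root_set H"
    \<comment> \<open>One radius serves the whole annulus, since
      \<open>2 * r \<le> 2 * cmod z\<close>.\<close>
    proof (rule power_series_root_of_contraction[where B = 2])
      show "\<exists>a\<in>H. cmod (w + a) \<le> 2 * cmod z" if "cmod w \<le> 2" for w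
        using arc_dense_contraction[OF assms(1,2,4,5) that] z
        by (force simp: annulus_def)
    qed (use z \<open>1 / 2 < r\<close> in \<open>auto simp: annulus_def\<close>)
  qed
  have "annulus {r..<1} \<subseteq> closure (poly_root_set H)"
    using series power_series_root_in_closure[OF assms(4)] by (auto simp: annulus_def)
  then have inner: "annulus {r..1} \<subseteq> closure (poly_root_set H)"
    using annulus_closed_subset_closure[OF \<open>r < 1\<close>] closure_minimal[OF _ closed_closure]
    by blast
  show "annulus {r..inverse r} \<subseteq> closure (poly_root_set H)"
  proof
    fix z assume z: "z \<in> annulus {r..inverse r}"
    show "z \<in> closure (poly_root_set H)"
    proof (cases "cmod z \<le> 1")
      case True
      then show ?thesis
        using z inner by (auto simp: annulus_def)
    next
      case False
      then have "z \<noteq> 0"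
        by auto
      \<comment> \<open>Inversion maps the part of the annulus outside the unit disc into
        \<open>annulus {r..1}\<close>, which is already covered.\<close>
      with False have "r \<le> inverse (cmod z)" "inverse (cmod z) \<le> 1"
        using z \<open>1 / 2 < r\<close> le_imp_inverse_le[of "cmod z" "inverse r"]
        by (auto simp: annulus_def inverse_le_1_iff)
      then have "inverse z \<in> closure (poly_root_set H)"
        using inner by (auto simp: annulus_def norm_inverse)
      then show ?thesis
        using inverse_in_closure_poly_root_set[of "inverse z"] \<open>z \<noteq> 0\<close> by simp
    qed
  qed
qed

end
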